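(* Let $(P,\le,{}',0,1)$ be a complemented orthogonal modular poset. Then for all $x,y\in P$: $x'\le y$ implies $y=x'\vee(y\wedge x)$, and $x\le y$ implies $x=(y'\vee x)\wedge y$. Hence, in every saturated complemented orthogonal modular poset the generalized Sasaki operations $\odot$ and $\to$ form an adjoint pair.
   Context: For a poset $(P,\le)$ and $A\subseteq P$, $L(A)$ and $U(A)$ denote the sets of all lower bounds, respectively upper bounds, of $A$. Write $L(a,b)$ for $L(\{a,b\})$, $L(A,b)$ for $L(A\cup\{b\})$, $LU(A)$ for $L(U(A))$, and similarly in analogous cases. $\operatorname{Max}A$ and $\operatorname{Min}A$ denote the sets of maximal, respectively minimal, elements of $A$. $x\vee y$ and $x\wedge y$ denote supremum and infimum in $P$ and are said to be defined if they exist. The poset $(P,\le)$ is modular if for all $x,y,z\in P$ with $x\le z$ we have $L\big(U(x,y),z\big)=LU\big(x,L(y,z)\big)$ (equivalently, $U\big(x,L(y,z)\big)=UL\big(U(x,y),z\big)$). A complemented poset $(P,\le,{}',0,1)$ is a bounded poset (least element $0$, greatest element $1$) with a unary operation $'$ that is a complementation, i.e. $x\vee x'=1$ and $x\wedge x'=0$ for all $x\in P$. It is orthogonal if for all $a,b\in P$: if $a\le b$ then $a\vee b'$ is defined; and if $a'\le b$ then $a\wedge b$ is defined. It is saturated if for all $x,y\in P$: every element of $L(x,y)$ lies below some element of $\operatorname{Max}L(x,y)$, and every element of $U(x,y)$ lies above some element of $\operatorname{Min}U(x,y)$. The generalized Sasaki operations assign to $x,y\in P$ the subsets $x\odot y:=\{m\wedge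 y\mid m\in\operatorname{Min}U(x,y')\}$ and $x\to y:=\{x'\vee m\mid m\in\operatorname{Max}L(x,y)\}$ of $P$ (in a bounded orthogonal saturated poset all these meets and joins exist). For $A\subseteq P$ and $x,z\in P$: $A\le_2 z$ means that there is $a\in A$ with $a\le z$; $x\le_1 A$ means that there is $a\in A$ with $x\le a$. The generalized Sasaki operations form an adjoint pair if for all $x,y,z\in P$: $x\odot y\le_2 z$ if and only if $x\le_1 y\to z$. *)

theory Defs
  imports "HOL-Algebra.Lattice"
begin

text \<open>
  Posets are the carrier-based \<^locale>\<open>partial_order\<close> structures of HOL-Algebra, so
  \<^const>\<open>Upper\<close>, \<^const>\<open>Lower\<close>, \<^const>\<open>join\<close> and \<^const>\<open>meet\<close> are the library's.
  The latter two are choice-based total functions, meaningful only where the supremum or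
  infimum exists; partiality is therefore tracked by the following two predicates.
\<close>

definition join_defined :: "('a, 'b) gorder_scheme \<Rightarrow> 'a \<Rightarrow> 'a \<Rightarrow> bool"
  where "join_defined P x y \<longleftrightarrow> (\<exists>s. is_lub P s {x, y})"

definition meet_defined :: "('a, 'b) gorder_scheme \<Rightarrow> 'a \<Rightarrow> 'a \<Rightarrow> bool"
  where "meet_defined P x y \<longleftrightarrow> (\<exists>i. is_glb P i {x, y})"

definition Max_elems :: "('a, 'b) gorder_scheme \<Rightarrow> 'a set \<Rightarrow> 'a set"
  where "Max_elems P A = {m \<in> A. \<forall>a\<in>A. m \<sqsubseteq>\<^bsub>P\<^esub> a \<longrightarrow> a = m}"

definition Min_elems :: "('a, 'b) gorder_scheme \<Rightarrow> 'a set \<Rightarrow> 'a set"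
  where "Min_elems P A = {m \<in> A. \<forall>a\<in>A. a \<sqsubseteq>\<^bsub>P\<^esub> m \<longrightarrow> a = m}"

definition modular_poset :: "('a, 'b) gorder_scheme \<Rightarrow> bool"
  where "modular_poset P \<longleftrightarrow>
    (\<forall>x\<in>carrier P. \<forall>y\<in>carrier P. \<forall>z\<in>carrier P. x \<sqsubseteq>\<^bsub>P\<^esub> z \<longrightarrow>
      Lower P (Upper P {x, y} \<union> {z}) = Lower P (Upper P ({x} \<union> Lower P {y, z})))"

definition saturated_poset :: "('a, 'b) gorder_scheme \<Rightarrow> bool"
  where "saturated_poset P \<longleftrightarrow>
    (\<forall>x\<in>carrier P. \<forall>y\<in>carrier P.
      (\<forall>a\<in>Lower P {x, y}. \<exists>m\<in>Max_elems P (Lower P {x, y}). a \<sqsubseteq>\<^bsub>P\<^esub> m) \<and>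
      (\<forall>a\<in>Upper P {x, y}. \<exists>m\<in>Min_elems P (Upper P {x, y}). m \<sqsubseteq>\<^bsub>P\<^esub> a))"

record 'a compl_order = "'a gorder" +
  compl :: "'a \<Rightarrow> 'a" (\<open>_\<acute>\<index>\<close> [1000] 999)

text \<open>The constants 0 and 1 are not separate parameters: they are \<open>\<bottom>\<close> and \<open>\<top>\<close>.\<close>

locale complemented_poset =
  partial_order P + weak_partial_order_bottom P + weak_partial_order_top P
  for P (structure) +
  assumes compl_closed: "x \<in> carrier P \<Longrightarrow> x\<acute> \<in> carrier P"
    and compl_lub: "x \<in> carrier P \<Longrightarrow> is_lub P \<top> {x, x\<acute>}"
    and compl_glb: "x \<in> carrier P \<Longrightarrow> is_glb P \<bottom> {x, x\<acute>}"

definition orthogonal_poset :: "('a, 'b) compl_order_scheme \<Rightarrow> bool"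
  where "orthogonal_poset P \<longleftrightarrow>
    (\<forall>a\<in>carrier P. \<forall>b\<in>carrier P.
      (a \<sqsubseteq>\<^bsub>P\<^esub> b \<longrightarrow> join_defined P a (b\<acute>\<^bsub>P\<^esub>)) \<and>
      (a\<acute>\<^bsub>P\<^esub> \<sqsubseteq>\<^bsub>P\<^esub> b \<longrightarrow> meet_defined P a b))"

text \<open>
  In a complemented orthogonal poset all meets and joins in the next two definitions exist:
  \<open>m \<in> U(x, y\<acute>)\<close> gives \<open>y\<acute> \<le> m\<close>, and \<open>m \<in> L(x, y)\<close> gives \<open>m \<le> x\<close>.
\<close>

definition sasaki_prod :: "('a, 'b) compl_order_scheme \<Rightarrow> 'a \<Rightarrow> 'a \<Rightarrow> 'a set"
  where "sasaki_prod P x y = {m \<sqinter>\<^bsub>P\<^esub> y | m. m \<in> Min_elems P (Upper P {x, y\<acute>\<^bsub>P\<^esub>})}"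

definition sasaki_imp :: "('a, 'b) compl_order_scheme \<Rightarrow> 'a \<Rightarrow> 'a \<Rightarrow> 'a set"
  where "sasaki_imp P x y = {x\<acute>\<^bsub>P\<^esub> \<squnion>\<^bsub>P\<^esub> m | m. m \<in> Max_elems P (Lower P {x, y})}"

definition set_le2 :: "('a, 'b) gorder_scheme \<Rightarrow> 'a set \<Rightarrow> 'a \<Rightarrow> bool"
  where "set_le2 P A z \<longleftrightarrow> (\<exists>a\<in>A. a \<sqsubseteq>\<^bsub>P\<^esub> z)"

definition set_le1 :: "('a, 'b) gorder_scheme \<Rightarrow> 'a \<Rightarrow> 'a set \<Rightarrow> bool"
  where "set_le1 P x A \<longleftrightarrow> (\<exists>a\<in>A. x \<sqsubseteq>\<^bsub>P\<^esub> a)"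

definition adjoint_pair ::
  "('a, 'b) gorder_scheme \<Rightarrow> ('a \<Rightarrow> 'a \<Rightarrow> 'a set) \<Rightarrow> ('a \<Rightarrow> 'a \<Rightarrow> 'a set) \<Rightarrow> bool"
  where "adjoint_pair P f g \<longleftrightarrow>
    (\<forall>x\<in>carrier P. \<forall>y\<in>carrier P. \<forall>z\<in>carrier P.
      set_le2 P (f x y) z \<longleftrightarrow> set_le1 P x (g y z))"

end

theory Submission
  imports Defs
begin

text \<open>
  For \<open>x \<sqsubseteq> z\<close>, modularity equates the cones \<open>L(U(x, y), z)\<close> and \<open>LU(x, L(y, z))\<close>.  When
  \<open>x \<squnion> y\<close>, \<open>y \<sqinter> z\<close> and \<open>x \<squnion> (y \<sqinter> z)\<close> exist, the first cone is \<open>L(x \<squnion> y, z)\<close> and the second is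
  the principal one \<open>L(x \<squnion> (y \<sqinter> z))\<close>.  Hence \<open>(x \<squnion> y) \<sqinter> z\<close> exists as well and equals
  \<open>x \<squnion> (y \<sqinter> z)\<close>, as in a modular lattice (\<open>modular_law\<close>).

  Putting a complementary pair into this law makes one of the inner terms \<open>\<top>\<close> or \<open>\<bottom>\<close>.  If
  \<open>x\<acute> \<sqsubseteq> y\<close>, then \<open>y = (x\<acute> \<squnion> x) \<sqinter> y = x\<acute> \<squnion> (x \<sqinter> y)\<close>.  If \<open>x \<sqsubseteq> y\<close>, then
  \<open>(x \<squnion> y\<acute>) \<sqinter> y = x \<squnion> (y\<acute> \<sqinter> y) = x\<close>.  Orthogonality provides the remaining joins and meets.

  These two cancellation identities say that, for fixed \<open>y\<close>, the monotone maps \<open>m \<mapsto> m \<sqinter> y\<close> from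
  the elements above \<open>y\<acute>\<close> to the elements below \<open>y\<close> and \<open>n \<mapsto> y\<acute> \<squnion> n\<close> in the other direction
  are inverse to each other.  Adjointness follows by transporting a witness along one of these
  maps and using saturation to replace the resulting bound by a minimal upper or a maximal lower
  bound (\<open>sasaki_adjoint\<close>).
\<close>

context partial_order
begin

lemma join_eqI: "is_lub L s {x, y} \<Longrightarrow> x \<squnion> y = s"
  unfolding join_def sup_def by (blast intro: least_unique)

lemma meet_eqI: "is_glb L i {x, y} \<Longrightarrow> x \<sqinter> y = i"
  unfolding meet_def inf_def by (blast intro: greatest_unique)

lemma join_is_lub: "join_defined L x y \<Longrightarrow> is_lub L (x \<squnion> y) {x, y}"
  unfolding join_defined_def using join_eqI by blast

lemma meet_is_glb: "meet_defined L x y \<Longrightarrow> is_glb L (x \<sqinter> y) {x, y}"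
  unfolding meet_defined_def using meet_eqI by blast

lemma is_lub_pair_iff:
  assumes "x \<in> carrier L" "y \<in> carrier L"
  shows "is_lub L s {x, y} \<longleftrightarrow>
    s \<in> carrier L \<and> x \<sqsubseteq> s \<and> y \<sqsubseteq> s \<and> (\<forall>u\<in>carrier L. x \<sqsubseteq> u \<longrightarrow> y \<sqsubseteq> u \<longrightarrow> s \<sqsubseteq> u)"
  using assms by (auto simp: least_def Upper_def)

lemma is_glb_pair_iff:
  assumes "x \<in> carrier L" "y \<in> carrier L"
  shows "is_glb L i {x, y} \<longleftrightarrow>
    i \<in> carrier L \<and> i \<sqsubseteq> x \<and> i \<sqsubseteq> y \<and> (\<forall>l\<in>carrier L. l \<sqsubseteq> x \<longrightarrow> l \<sqsubseteq> y \<longrightarrow> l \<sqsubseteq> i)"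
  using assms by (auto simp: greatest_def Lower_def)

lemma join_mono:
  assumes "join_defined L x y" "join_defined L x z" "y \<sqsubseteq> z"
    and "x \<in> carrier L" "y \<in> carrier L" "z \<in> carrier L"
  shows "x \<squnion> y \<sqsubseteq> x \<squnion> z"
  using assms join_is_lub[of x y] join_is_lub[of x z] le_trans[of y z "x \<squnion> z"]
  by (simp add: is_lub_pair_iff)

lemma meet_mono:
  assumes "meet_defined L x z" "meet_defined L y z" "x \<sqsubseteq> y"
    and "x \<in> carrier L" "y \<in> carrier L" "z \<in> carrier L"
  shows "x \<sqinter> z \<sqsubseteq> y \<sqinter> z"
  using assms meet_is_glb[of x z] meet_is_glb[of y z] le_trans[of "x \<sqinter> z" x y]
  by (simp add: is_glb_pair_iff)

lemma Lower_Upper_is_lub: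
  assumes "is_lub L s A"
  shows "Lower L (Upper L A) = Lower L {s}"
proof
  show "Lower L (Upper L A) \<subseteq> Lower L {s}"
    using least_mem[OF assms] by (intro Lower_antimono) simp
  show "Lower L {s} \<subseteq> Lower L (Upper L A)"
  proof
    fix l assume "l \<in> Lower L {s}"
    then have l: "l \<in> carrier L" "l \<sqsubseteq> s"
      using least_closed[OF assms] by (simp_all add: Lower_def)
    show "l \<in> Lower L (Upper L A)"
    proof (rule Lower_memI)
      fix u assume u: "u \<in> Upper L A"
      then have "u \<in> carrier L"
        by (simp add: Upper_def)
      then show "l \<sqsubseteq> u"
        using le_trans[OF l(2) least_le[OF assms u]] l(1) least_closed[OF assms] by simp
    qed fact
  qed
qed

lemma Upper_Lower_is_glb:
  assumes "is_glb L i A"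
  shows "Upper L (Lower L A) = Upper L {i}"
proof
  show "Upper L (Lower L A) \<subseteq> Upper L {i}"
    using greatest_mem[OF assms] by (intro Upper_antimono) simp
  show "Upper L {i} \<subseteq> Upper L (Lower L A)"
  proof
    fix u assume "u \<in> Upper L {i}"
    then have u: "u \<in> carrier L" "i \<sqsubseteq> u"
      using greatest_closed[OF assms] by (simp_all add: Upper_def)
    show "u \<in> Upper L (Lower L A)"
    proof (rule Upper_memI)
      fix l assume l: "l \<in> Lower L A"
      then have "l \<in> carrier L"
        by (simp add: Lower_def)
      then show "l \<sqsubseteq> u"
        using le_trans[OF greatest_le[OF assms l] u(2)] u(1) greatest_closed[OF assms] by simp
    qed fact
  qed
qed

lemma Upper_Un: "Upper L (A \<union> B) = Upper L A \<inter> Upper L B"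
  by (auto simp: Upper_def)

lemma Lower_Un: "Lower L (A \<union> B) = Lower L A \<inter> Lower L B"
  by (auto simp: Lower_def)

text \<open>
  If \<open>j\<close> is the supremum of \<open>x, y\<close> and \<open>m\<close> the infimum of \<open>y, z\<close>, then \<open>L(U(x, y), z) = L(j, z)\<close>
  and \<open>U(x, L(y, z)) = U(x, m)\<close>, because bounding a cone amounts to bounding its extremal element.
  If \<open>s\<close> is the supremum of \<open>x, m\<close>, the latter has lower cone \<open>L(s)\<close>, so modularity yields
  \<open>L(j, z) = L(s)\<close>.
\<close>

lemma modular_law:
  assumes mod: "modular_poset L"
    and carr: "x \<in> carrier L" "y \<in> carrier L" "z \<in> carrier L"
    and "x \<sqsubseteq> z"
    and j: "is_lub L j {x, y}" and m: "is_glb L m {y, z}" and s: "is_lub L s {x, m}"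
  shows "is_glb L s {j, z}"
proof -
  have "Lower L {j, z} = Lower L (Upper L {x, y} \<union> {z})"
    using Lower_Un[of "{j}" "{z}"] Lower_Un[of "Upper L {x, y}" "{z}"] Lower_Upper_is_lub[OF j]
    by (simp add: insert_commute)
  also have "\<dots> = Lower L (Upper L ({x} \<union> Lower L {y, z}))"
    using mod carr \<open>x \<sqsubseteq> z\<close> unfolding modular_poset_def by blast
  also have "Upper L ({x} \<union> Lower L {y, z}) = Upper L {x, m}"
    using Upper_Un[of "{x}" "Lower L {y, z}"] Upper_Un[of "{x}" "{m}"] Upper_Lower_is_glb[OF m]
    by (simp add: insert_commute)
  also have "Lower L (Upper L {x, m}) = Lower L {s}"
    by (rule Lower_Upper_is_lub[OF s])
  finally show ?thesis
    using least_closed[OF s] by (auto simp: greatest_def Lower_def)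
qed

end

context complemented_poset
begin

lemma orthogonal_join_defined:
  assumes "orthogonal_poset P" "x \<sqsubseteq> y" "x \<in> carrier P" "y \<in> carrier P"
  shows "join_defined P (y\<acute>) x"
  using assms by (simp add: orthogonal_poset_def join_defined_def insert_commute)

lemma orthogonal_meet_defined:
  assumes "orthogonal_poset P" "x\<acute> \<sqsubseteq> y" "x \<in> carrier P" "y \<in> carrier P"
  shows "meet_defined P y x"
  using assms by (simp add: orthogonal_poset_def meet_defined_def insert_commute)

lemma orthogonal_join_meet_defined:
  assumes orth: "orthogonal_poset P" and "x\<acute> \<sqsubseteq> y" and carr: "x \<in> carrier P" "y \<in> carrier P"
  shows "join_defined P (x\<acute>) (y \<sqinter> x)"
proof -
  have "y \<sqinter> x \<in> carrier P" "y \<sqinter> x \<sqsubseteq> x"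
    using meet_is_glb[OF orthogonal_meet_defined[OF assms]] carr by (simp_all add: is_glb_pair_iff)
  then show ?thesis
    using orthogonal_join_defined[OF orth] carr by simp
qed

lemma orthogonal_meet_join_defined:
  assumes orth: "orthogonal_poset P" and "x \<sqsubseteq> y" and carr: "x \<in> carrier P" "y \<in> carrier P"
  shows "meet_defined P (y\<acute> \<squnion> x) y"
proof -
  have "y\<acute> \<squnion> x \<in> carrier P" "y\<acute> \<sqsubseteq> y\<acute> \<squnion> x"
    using join_is_lub[OF orthogonal_join_defined[OF assms]] carr compl_closed
    by (simp_all add: is_lub_pair_iff)
  then show ?thesis
    using orthogonal_meet_defined[OF orth] carr by simp
qed

text \<open>The modular law for \<open>x\<acute> \<sqsubseteq> y\<close> and the middle element \<open>x\<close>, whose join with \<open>x\<acute>\<close> is \<open>\<top>\<close>.\<close>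

lemma modular_join_meet_cancel:
  assumes orth: "orthogonal_poset P" and mod: "modular_poset P"
    and le: "x\<acute> \<sqsubseteq> y" and carr: "x \<in> carrier P" "y \<in> carrier P"
  shows "x\<acute> \<squnion> (y \<sqinter> x) = y"
proof -
  have top: "is_lub P \<top> {x\<acute>, x}"
    using compl_lub[OF carr(1)] by (simp add: insert_commute)
  have meet: "is_glb P (y \<sqinter> x) {x, y}"
    using meet_is_glb[OF orthogonal_meet_defined[OF orth le carr]] by (simp add: insert_commute)
  have join: "is_lub P (x\<acute> \<squnion> (y \<sqinter> x)) {x\<acute>, y \<sqinter> x}"
    using join_is_lub[OF orthogonal_join_meet_defined[OF orth le carr]] .
  have "is_glb P (x\<acute> \<squnion> (y \<sqinter> x)) {\<top>, y}"
    using modular_law[OF mod compl_closed[OF carr(1)] carr le top meet join] .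
  moreover have "is_glb P y {\<top>, y}"
    using carr by (simp add: is_glb_pair_iff)
  ultimately show ?thesis
    by (rule greatest_unique)
qed

text \<open>The modular law for \<open>x \<sqsubseteq> y\<close> and the middle element \<open>y\<acute>\<close>, whose meet with \<open>y\<close> is \<open>\<bottom>\<close>.\<close>

lemma modular_meet_join_cancel:
  assumes orth: "orthogonal_poset P" and mod: "modular_poset P"
    and le: "x \<sqsubseteq> y" and carr: "x \<in> carrier P" "y \<in> carrier P"
  shows "(y\<acute> \<squnion> x) \<sqinter> y = x"
proof -
  have join: "is_lub P (y\<acute> \<squnion> x) {x, y\<acute>}"
    using join_is_lub[OF orthogonal_join_defined[OF orth le carr]] by (simp add: insert_commute)
  have bottom: "is_glb P \<bottom> {y\<acute>, y}"
    using compl_glb[OF carr(2)] by (simp add: insert_commute)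
  have "is_lub P x {x, \<bottom>}"
    using carr by (simp add: is_lub_pair_iff)
  then have "is_glb P x {y\<acute> \<squnion> x, y}"
    by (rule modular_law[OF mod carr(1) compl_closed[OF carr(2)] carr(2) le join bottom])
  then show ?thesis
    by (rule meet_eqI)
qed

text \<open>
  If \<open>m \<sqinter> y \<sqsubseteq> z\<close> with \<open>m\<close> minimal above \<open>x\<close> and \<open>y\<acute>\<close>, then \<open>m \<sqinter> y\<close> is a lower bound of \<open>y, z\<close>, so
  some maximal lower bound \<open>n\<close> lies above it and \<open>x \<sqsubseteq> m = y\<acute> \<squnion> (m \<sqinter> y) \<sqsubseteq> y\<acute> \<squnion> n\<close>.  Conversely, if
  \<open>x \<sqsubseteq> y\<acute> \<squnion> n\<close> with \<open>n\<close> maximal below \<open>y\<close> and \<open>z\<close>, then \<open>y\<acute> \<squnion> n\<close> is an upper bound of \<open>x, y\<acute>\<close>, so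
  some minimal upper bound \<open>m\<close> lies below it and \<open>m \<sqinter> y \<sqsubseteq> (y\<acute> \<squnion> n) \<sqinter> y = n \<sqsubseteq> z\<close>.
\<close>

lemma sasaki_adjoint:
  assumes orth: "orthogonal_poset P" and sat: "saturated_poset P"
    and join_meet_cancel:
      "\<And>x y. \<lbrakk>x\<acute> \<sqsubseteq> y; x \<in> carrier P; y \<in> carrier P\<rbrakk> \<Longrightarrow> x\<acute> \<squnion> (y \<sqinter> x) = y"
    and meet_join_cancel:
      "\<And>x y. \<lbrakk>x \<sqsubseteq> y; x \<in> carrier P; y \<in> carrier P\<rbrakk> \<Longrightarrow> (y\<acute> \<squnion> x) \<sqinter> y = x"
  shows "adjoint_pair P (sasaki_prod P) (sasaki_imp P)"
  unfolding adjoint_pair_def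
proof (intro ballI iffI)
  fix x y z
  assume carr: "x \<in> carrier P" "y \<in> carrier P" "z \<in> carrier P"
  note y' = compl_closed[OF carr(2)]
  {
    assume "set_le2 P (sasaki_prod P x y) z"
    then obtain m where m: "m \<in> carrier P" "x \<sqsubseteq> m" "y\<acute> \<sqsubseteq> m" and mz: "m \<sqinter> y \<sqsubseteq> z"
      using carr y' by (auto simp: set_le2_def sasaki_prod_def Min_elems_def Upper_def)
    have meet: "is_glb P (m \<sqinter> y) {m, y}"
      using meet_is_glb[OF orthogonal_meet_defined[OF orth m(3) carr(2) m(1)]] .
    have my: "m \<sqinter> y \<in> carrier P" "m \<sqinter> y \<sqsubseteq> y"
      using meet m carr by (simp_all add: is_glb_pair_iff)
    have "m \<sqinter> y \<in> Lower P {y, z}"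
      using my mz by (auto simp: Lower_def)
    then obtain n where n: "n \<in> Max_elems P (Lower P {y, z})" and mn: "m \<sqinter> y \<sqsubseteq> n"
      using sat carr unfolding saturated_poset_def by blast
    have nL: "n \<in> carrier P" "n \<sqsubseteq> y"
      using n carr by (auto simp: Max_elems_def Lower_def)
    have join: "is_lub P (y\<acute> \<squnion> n) {y\<acute>, n}"
      using join_is_lub[OF orthogonal_join_defined[OF orth nL(2,1) carr(2)]] .
    have "m = y\<acute> \<squnion> (m \<sqinter> y)"
      using join_meet_cancel[OF m(3) carr(2) m(1)] by simp
    also have "\<dots> \<sqsubseteq> y\<acute> \<squnion> n"
      using join_mono[OF orthogonal_join_defined[OF orth my(2,1) carr(2)]
          orthogonal_join_defined[OF orth nL(2,1) carr(2)] mn y' my(1) nL(1)] .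
    finally have "x \<sqsubseteq> y\<acute> \<squnion> n"
      using le_trans[OF m(2)] m(1) carr(1) least_closed[OF join] by simp
    then show "set_le1 P x (sasaki_imp P y z)"
      unfolding set_le1_def sasaki_imp_def using n by blast
  next
    assume "set_le1 P x (sasaki_imp P y z)"
    then obtain n where n: "n \<in> carrier P" "n \<sqsubseteq> y" "n \<sqsubseteq> z" and xn: "x \<sqsubseteq> y\<acute> \<squnion> n"
      using carr by (auto simp: set_le1_def sasaki_imp_def Max_elems_def Lower_def)
    have join: "is_lub P (y\<acute> \<squnion> n) {y\<acute>, n}"
      using join_is_lub[OF orthogonal_join_defined[OF orth n(2,1) carr(2)]] .
    have yn: "y\<acute> \<squnion> n \<in> carrier P" "y\<acute> \<sqsubseteq> y\<acute> \<squnion> n"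
      using join n y' by (simp_all add: is_lub_pair_iff)
    have "y\<acute> \<squnion> n \<in> Upper P {x, y\<acute>}"
      using yn xn by (auto simp: Upper_def)
    then obtain m where m: "m \<in> Min_elems P (Upper P {x, y\<acute>})" and mn: "m \<sqsubseteq> y\<acute> \<squnion> n"
      using sat carr y' unfolding saturated_poset_def by blast
    have mU: "m \<in> carrier P" "y\<acute> \<sqsubseteq> m"
      using m y' by (auto simp: Min_elems_def Upper_def)
    have meet: "is_glb P (m \<sqinter> y) {m, y}"
      using meet_is_glb[OF orthogonal_meet_defined[OF orth mU(2) carr(2) mU(1)]] .
    have "m \<sqinter> y \<sqsubseteq> (y\<acute> \<squnion> n) \<sqinter> y"
      using meet_mono[OF orthogonal_meet_defined[OF orth mU(2) carr(2) mU(1)]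
          orthogonal_meet_defined[OF orth yn(2) carr(2) yn(1)] mn mU(1) yn(1) carr(2)] .
    also have "\<dots> = n"
      using meet_join_cancel[OF n(2,1) carr(2)] .
    finally have "m \<sqinter> y \<sqsubseteq> z"
      using le_trans[OF _ n(3)] n(1) carr(3) greatest_closed[OF meet] by simp
    then show "set_le2 P (sasaki_prod P x y) z"
      unfolding set_le2_def sasaki_prod_def using m by blast
  }
qed

end

theorem corollary4p4:
  fixes P :: "('a, 'b) compl_order_scheme" (structure)
  assumes "complemented_poset P" and "orthogonal_poset P" and "modular_poset P"
  shows "(\<forall>x\<in>carrier P. \<forall>y\<in>carrier P.
           (x\<acute> \<sqsubseteq> y \<longrightarrow>
              meet_defined P y x \<and> join_defined P (x\<acute>) (y \<sqinter> x) \<and>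
              y = x\<acute> \<squnion> (y \<sqinter> x)) \<and>
           (x \<sqsubseteq> y \<longrightarrow>
              join_defined P (y\<acute>) x \<and> meet_defined P (y\<acute> \<squnion> x) y \<and>
              x = (y\<acute> \<squnion> x) \<sqinter> y)) \<and>
         (saturated_poset P \<longrightarrow> adjoint_pair P (sasaki_prod P) (sasaki_imp P))"
proof -
  interpret complemented_poset P
    by fact
  note orth = \<open>orthogonal_poset P\<close> and mod = \<open>modular_poset P\<close>
  note cancel = modular_join_meet_cancel[OF orth mod] modular_meet_join_cancel[OF orth mod]
  show ?thesis
    using orthogonal_meet_defined[OF orth] orthogonal_join_meet_defined[OF orth]
      orthogonal_join_defined[OF orth] orthogonal_meet_join_defined[OF orth]
      cancel sasaki_adjoint[OF orth _ cancel]
    by simp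
qed

end
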